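(* Let $(X,d)$ be a complete metric space, let $\mathscr{G}$ be a generalized process in $X$ which is asymptotically autonomous for a quasi-invariant global selected pullback attractor $\mathcal{A}=\{\mathcal{A}(t)\}_{t\in\mathbb{R}}$ of $\mathscr{G}$, and let $\mathcal{A}_\infty$ be the global attractor of the corresponding autonomous problem. If $\mathcal{A}$ is forward compact, i.e., $\overline{\bigcup_{s\ge t}\mathcal{A}(s)}$ is compact for all $t\in\mathbb{R}$, then $$\lim_{t\to\infty}\mathrm{dist}(\mathcal{A}(t),\mathcal{A}_\infty)=0.$$
   Context: Let $(X,d)$ be a complete metric space. For nonempty $A,B\subset X$: $\mathrm{dist}(A,B)=\sup_{a\in A}\inf_{b\in B}d(a,b)$; for $\varepsilon>0$, $\mathcal{O}_\varepsilon(A)=\{z\in X:\inf_{a\in A}d(z,a)<\varepsilon\}$. Generalized process: a family $\mathscr{G}=\{\mathscr{G}(\tau)\}_{\tau\in\mathbb{R}}$ of sets $\mathscr{G}(\tau)$ consisting of functions $\varphi:[\tau,\infty)\to X$ (called solutions) such that: (C1) for each $\tau\in\mathbb{R}$ and $z\in X$ there is at least one $\varphi\in\mathscr{G}(\tau)$ with $\varphi(\tau)=z$; (C2) if $\varphi\in\mathscr{G}(\tau)$ and $s\ge 0$, then $\varphi|_{[\tau+s,\infty)}\in\mathscr{G}(\tau+s)$; (C3) if $\{\varphi_j\}_{j\in\mathbb{N}}\subset\mathscr{G}(\tau)$ and $\varphi_j(\tau)\to z$, then there are a subsequence $\{\varphi_{j_k}\}$ and $\varphi\in\mathscr{G}(\tau)$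 with $\varphi(\tau)=z$ and $\varphi_{j_k}(t)\to\varphi(t)$ as $k\to\infty$ for each $t\ge\tau$. A complete orbit (complete trajectory) through $x\in X$ at $\tau\in\mathbb{R}$ is a map $\psi:\mathbb{R}\to X$ with $\psi(\tau)=x$ and $\psi|_{[\tau+s,\infty)}\in\mathscr{G}(\tau+s)$ for all $s\in\mathbb{R}$. A family $\mathcal{A}=\{\mathcal{A}(t)\}_{t\in\mathbb{R}}$ of subsets of $X$ is quasi-invariant if for each $\tau\in\mathbb{R}$ and $z\in\mathcal{A}(\tau)$ there is a complete orbit $\psi$ through $z$ at $\tau$ with $\psi(t)\in\mathcal{A}(t)$ for all $t\in\mathbb{R}$. $\mathcal{A}$ select pullback attracts $x\in X$ at time $t\in\mathbb{R}$ if for every $\varepsilon>0$ there is $\tau_0\le t$ such that for all $\tau\le\tau_0$ there is $\varphi_\tau\in\mathscr{G}(\tau)$ with $\varphi_\tau(\tau)=x$ and $\varphi_\tau(t)\in\mathcal{O}_\varepsilon(\mathcal{A}(t))$. A global selected pullback attractor of $\mathscr{G}$ is a family of nonempty compact subsets $\mathcal{A}(t)$, $t\in\mathbb{R}$, of $X$ which select pullback attracts every $x\in X$ at every time $t\in\mathbb{R}$. Autonomous problem: it is given by a set $\mathcal{S}$ of functions $\varphi:[0,\infty)\to X$ (its solutions) such that every $z\in X$ is the initial value $\varphi(0)$ of some $\varphi\in\mathcal{S}$ and $\varphi(\cdot+s)\in\mathcal{S}$ for $\varphi\in\mathcal{S}$, $s\ge0$. Its multivalued semigroup is $G(t,B)=\{\varphi(t):\varphi\in\mathcal{S},\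 \varphi(0)\in B\}$, $t\ge 0$, $B\subset X$. Its global attractor $\mathcal{A}_\infty$ is a nonempty compact set with $\mathcal{A}_\infty\subset G(t,\mathcal{A}_\infty)$ for all $t\ge0$ and $\mathrm{dist}(G(t,B),\mathcal{A}_\infty)\to0$ as $t\to\infty$ for every nonempty bounded $B\subset X$. $\mathscr{G}$ is asymptotically autonomous for $\mathcal{A}$ (a quasi-invariant global selected pullback attractor), with corresponding autonomous problem $\mathcal{S}$, if: for every sequence of times $\tau\to\infty$ and points $x_\tau\in\mathcal{A}(\tau)$ with $x_\tau\to x_0$ in $X$ as $\tau\to\infty$, and all complete trajectories $\varphi_\tau$ with $\varphi_\tau(\tau)=x_\tau$ and $\varphi_\tau(s)\in\mathcal{A}(s)$ for all $s\in\mathbb{R}$, there is a solution $\varphi\in\mathcal{S}$ of the autonomous problem with $\varphi(0)=x_0$ and $\varphi_\tau(t+\tau)\to\varphi(t)$ as $\tau\to\infty$ along the sequence, for each $t\ge0$. *)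

theory Defs
  imports "HOL-Analysis.Analysis"
begin

(* Hausdorff semidistance of nonempty sets. It takes values in ennreal because the supremum can be
   infinite: the values of a multivalued semigroup on a bounded set need not be bounded. *)
definition semidist :: "'a::metric_space set \<Rightarrow> 'a set \<Rightarrow> ennreal" where
  "semidist A B = (SUP a\<in>A. ennreal (infdist a B))"

definition eps_nbhd :: "real \<Rightarrow> 'a::metric_space set \<Rightarrow> 'a set" where
  "eps_nbhd \<epsilon> A = {z. infdist z A < \<epsilon>}"

(* A function on [\<tau>,\<infinity>) is an element of extensional {\<tau>..}, i.e. a total function with the fixed value
   undefined outside its domain, so that equality of such functions is equality on [\<tau>,\<infinity>). *)
definition generalized_process :: "(real \<Rightarrow> (real \<Rightarrow> 'a::metric_space) set) \<Rightarrow> bool" where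
  "generalized_process G \<longleftrightarrow>
     (\<forall>\<tau>. G \<tau> \<subseteq> extensional {\<tau>..}) \<and>
     (\<forall>\<tau> z. \<exists>\<phi>\<in>G \<tau>. \<phi> \<tau> = z) \<and>
     (\<forall>\<tau>. \<forall>\<phi>\<in>G \<tau>. \<forall>s\<ge>0. restrict \<phi> {\<tau> + s..} \<in> G (\<tau> + s)) \<and>
     (\<forall>\<tau> z (\<phi> :: nat \<Rightarrow> real \<Rightarrow> 'a). (\<forall>j. \<phi> j \<in> G \<tau>) \<longrightarrow> (\<lambda>j. \<phi> j \<tau>) \<longlonglongrightarrow> z \<longrightarrow>
        (\<exists>r :: nat \<Rightarrow> nat. strict_mono r \<and>
           (\<exists>\<phi>'\<in>G \<tau>. \<phi>' \<tau> = z \<and> (\<forall>t\<ge>\<tau>. (\<lambda>k. \<phi> (r k) t) \<longlonglongrightarrow> \<phi>' t))))"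

definition complete_orbit ::
  "(real \<Rightarrow> (real \<Rightarrow> 'a) set) \<Rightarrow> real \<Rightarrow> 'a \<Rightarrow> (real \<Rightarrow> 'a) \<Rightarrow> bool" where
  "complete_orbit G \<tau> x \<psi> \<longleftrightarrow> \<psi> \<tau> = x \<and> (\<forall>s. restrict \<psi> {\<tau> + s..} \<in> G (\<tau> + s))"

definition quasi_invariant ::
  "(real \<Rightarrow> (real \<Rightarrow> 'a) set) \<Rightarrow> (real \<Rightarrow> 'a set) \<Rightarrow> bool" where
  "quasi_invariant G A \<longleftrightarrow>
     (\<forall>\<tau>. \<forall>z\<in>A \<tau>. \<exists>\<psi>. complete_orbit G \<tau> z \<psi> \<and> (\<forall>t. \<psi> t \<in> A t))"

definition select_pullback_attracts ::
  "(real \<Rightarrow> (real \<Rightarrow> 'a::metric_space) set) \<Rightarrow> (real \<Rightarrow> 'a set) \<Rightarrow> 'a \<Rightarrow> real \<Rightarrow> bool" where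
  "select_pullback_attracts G A x t \<longleftrightarrow>
     (\<forall>\<epsilon>>0. \<exists>\<tau>\<^sub>0\<le>t. \<forall>\<tau>\<le>\<tau>\<^sub>0. \<exists>\<phi>\<in>G \<tau>. \<phi> \<tau> = x \<and> \<phi> t \<in> eps_nbhd \<epsilon> (A t))"

definition global_selected_pullback_attractor ::
  "(real \<Rightarrow> (real \<Rightarrow> 'a::metric_space) set) \<Rightarrow> (real \<Rightarrow> 'a set) \<Rightarrow> bool" where
  "global_selected_pullback_attractor G A \<longleftrightarrow>
     (\<forall>t. A t \<noteq> {} \<and> compact (A t)) \<and> (\<forall>x t. select_pullback_attracts G A x t)"

definition autonomous_problem :: "(real \<Rightarrow> 'a) set \<Rightarrow> bool" where
  "autonomous_problem S \<longleftrightarrow>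
     S \<subseteq> extensional {0..} \<and>
     (\<forall>z. \<exists>\<phi>\<in>S. \<phi> 0 = z) \<and>
     (\<forall>\<phi>\<in>S. \<forall>s\<ge>0. restrict (\<lambda>t. \<phi> (t + s)) {0..} \<in> S)"

definition multi_semigroup :: "(real \<Rightarrow> 'a) set \<Rightarrow> real \<Rightarrow> 'a set \<Rightarrow> 'a set" where
  "multi_semigroup S t B = {\<phi> t |\<phi>. \<phi> \<in> S \<and> \<phi> 0 \<in> B}"

definition global_attractor :: "(real \<Rightarrow> 'a::metric_space) set \<Rightarrow> 'a set \<Rightarrow> bool" where
  "global_attractor S Ainf \<longleftrightarrow>
     Ainf \<noteq> {} \<and> compact Ainf \<and>
     (\<forall>t\<ge>0. Ainf \<subseteq> multi_semigroup S t Ainf) \<and>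
     (\<forall>B. B \<noteq> {} \<longrightarrow> bounded B \<longrightarrow>
        ((\<lambda>t. semidist (multi_semigroup S t B) Ainf) \<longlongrightarrow> 0) at_top)"

definition asymptotically_autonomous ::
  "(real \<Rightarrow> (real \<Rightarrow> 'a::metric_space) set) \<Rightarrow> (real \<Rightarrow> 'a set) \<Rightarrow> (real \<Rightarrow> 'a) set \<Rightarrow> bool" where
  "asymptotically_autonomous G A S \<longleftrightarrow>
     (\<forall>(\<tau> :: nat \<Rightarrow> real) x x\<^sub>0 \<phi>.
        filterlim \<tau> at_top sequentially \<longrightarrow>
        (\<forall>n. x n \<in> A (\<tau> n)) \<longrightarrow> x \<longlonglongrightarrow> x\<^sub>0 \<longrightarrow>
        (\<forall>n. complete_orbit G (\<tau> n) (x n) (\<phi> n) \<and> (\<forall>s. \<phi> n s \<in> A s)) \<longrightarrow>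
        (\<exists>\<phi>'\<in>S. \<phi>' 0 = x\<^sub>0 \<and> (\<forall>t\<ge>0. (\<lambda>n. \<phi> n (t + \<tau> n)) \<longlonglongrightarrow> \<phi>' t)))"

definition forward_compact :: "(real \<Rightarrow> 'a::metric_space set) \<Rightarrow> bool" where
  "forward_compact A \<longleftrightarrow> (\<forall>t. compact (closure (\<Union>s\<in>{t..}. A s)))"

end

(* If dist (A t) Ainf does not tend to 0, there are points x n in A (t n), t n tending to infinity, that
   stay at distance at least some positive number from Ainf. Take a time T at which the autonomous
   problem brings the compact set K containing all later A s within that distance of Ainf, and follow complete orbits
   in A through x n back to time t n - T. A subsequence of the resulting points converges in K, so by
   asymptotic autonomy x n converges along it to a point of the image of K at time T: contradiction. *)
theory Submission
  imports Defs
begin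

text \<open>The offset \<open>s\<close> in \<open>complete_orbit\<close> ranges over all reals, so
  the restrictions required do not depend on the base time; only the normalising value
  changes.\<close>

lemma complete_orbit_shift:
  assumes "complete_orbit G \<tau> x \<psi>"
  shows "complete_orbit G \<sigma> (\<psi> \<sigma>) \<psi>"
proof -
  have "restrict \<psi> {\<sigma> + s..} \<in> G (\<sigma> + s)" for s
    using assms unfolding complete_orbit_def by (metis add_diff_cancel_left' add_diff_eq)
  then show ?thesis
    by (simp add: complete_orbit_def)
qed

lemma infdist_le_semidist: "x \<in> A \<Longrightarrow> ennreal (infdist x B) \<le> semidist A B"
  unfolding semidist_def by (rule SUP_upper)

lemma semidist_tendsto_0I:
  assumes "\<And>\<epsilon>. \<epsilon> > 0 \<Longrightarrow> \<forall>\<^sub>F t in F. \<forall>x\<in>A t. infdist x B \<le> \<epsilon>"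
  shows "((\<lambda>t. semidist (A t) B) \<longlongrightarrow> 0) F"
proof (rule order_tendstoI)
  fix e :: ennreal
  assume "0 < e"
  \<comment> \<open>Pointwise bounds pass to the supremum only as \<le>, so an intermediate
    \<open>d\<close> restores strictness. Lying below \<open>e\<close>, it is finite and hence comes
    from a real \<epsilon>.\<close>
  then obtain d where "0 < d" "d < e"
    using dense by blast
  then obtain \<epsilon> where \<epsilon>: "d = ennreal \<epsilon>" "\<epsilon> > 0"
    by (cases d) auto
  have "\<forall>\<^sub>F t in F. semidist (A t) B \<le> d"
    using assms[OF \<epsilon>(2)]
    by eventually_elim (auto simp: semidist_def \<epsilon> intro!: SUP_least ennreal_leI)
  then show "\<forall>\<^sub>F t in F. semidist (A t) B < e"
    by eventually_elim (use \<open>d < e\<close> in auto)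
qed simp

text \<open>Asymptotic autonomy needs convergent initial points. Compactness of \<open>K\<close>
  supplies them at the times \<open>t n - T\<close>, and the limit solution then carries the
  convergence forward by \<open>T\<close>.\<close>

lemma asymptotically_autonomous_limit:
  assumes qi: "quasi_invariant G A"
    and aa: "asymptotically_autonomous G A S"
    and K: "compact K" "\<And>s. s \<ge> s\<^sub>0 \<Longrightarrow> A s \<subseteq> K"
    and "T \<ge> 0"
    and t: "filterlim t at_top sequentially" "\<And>n. t n \<ge> s\<^sub>0 + T"
    and x: "\<And>n::nat. x n \<in> A (t n)"
  obtains r y where "strict_mono r" "y \<in> multi_semigroup S T K" "(x \<circ> r) \<longlonglongrightarrow> y"
proof -
  have "\<forall>n. \<exists>\<psi>. complete_orbit G (t n) (x n) \<psi> \<and> (\<forall>s. \<psi> s \<in> A s)"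
    using qi x by (simp add: quasi_invariant_def)
  then obtain \<psi> where \<psi>: "\<And>n. complete_orbit G (t n) (x n) (\<psi> n)" "\<And>n s. \<psi> n s \<in> A s"
    unfolding choice_iff by blast
  define \<tau> where "\<tau> n = t n - T" for n
  define y where "y n = \<psi> n (\<tau> n)" for n
  \<comment> \<open>The margin \<open>T\<close> in the lower bound on \<open>t n\<close> keeps
    \<open>\<tau> n\<close> at or above \<open>s\<^sub>0\<close>.\<close>
  have "y n \<in> K" for n
    using \<psi>(2)[of n "\<tau> n"] K(2)[of "\<tau> n"] t(2)[of n] by (auto simp: y_def \<tau>_def)
  then obtain y\<^sub>0 r where r: "y\<^sub>0 \<in> K" "strict_mono r" "(y \<circ> r) \<longlonglongrightarrow> y\<^sub>0"
    using K(1) unfolding compact_def by metis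
  have "filterlim \<tau> at_top sequentially"
    unfolding \<tau>_def using filterlim_tendsto_add_at_top[OF tendsto_const[of "- T"] t(1)] by simp
  then have "filterlim (\<tau> \<circ> r) at_top sequentially"
    using filterlim_compose filterlim_subseq[OF r(2)] unfolding o_def by blast
  moreover have "(y \<circ> r) n \<in> A ((\<tau> \<circ> r) n)" for n
    by (simp add: y_def \<psi>(2))
  moreover have "complete_orbit G ((\<tau> \<circ> r) n) ((y \<circ> r) n) ((\<psi> \<circ> r) n) \<and> (\<forall>s. (\<psi> \<circ> r) n s \<in> A s)" for n
    using complete_orbit_shift[OF \<psi>(1)] by (simp add: y_def \<psi>(2))
  ultimately have "\<exists>\<phi>\<in>S. \<phi> 0 = y\<^sub>0 \<and> (\<forall>u\<ge>0. (\<lambda>n. (\<psi> \<circ> r) n (u + (\<tau> \<circ> r) n)) \<longlonglongrightarrow> \<phi> u)"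
    using aa[unfolded asymptotically_autonomous_def, rule_format, of "\<tau> \<circ> r" "y \<circ> r" y\<^sub>0 "\<psi> \<circ> r"] r(3)
    by blast
  then obtain \<phi> where \<phi>: "\<phi> \<in> S" "\<phi> 0 = y\<^sub>0"
      "\<And>u. u \<ge> 0 \<Longrightarrow> (\<lambda>n. (\<psi> \<circ> r) n (u + (\<tau> \<circ> r) n)) \<longlonglongrightarrow> \<phi> u"
    by blast
  \<comment> \<open>Elapsed time \<open>T\<close> undoes the backward shift, since
    \<open>T + \<tau> n = t n\<close>.\<close>
  have "(\<psi> \<circ> r) n (T + (\<tau> \<circ> r) n) = (x \<circ> r) n" for n
    using \<psi>(1)[of "r n"] by (simp add: \<tau>_def complete_orbit_def)
  then have "(x \<circ> r) \<longlonglongrightarrow> \<phi> T"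
    using \<phi>(3)[OF \<open>T \<ge> 0\<close>] by (simp add: o_def)
  moreover have "\<phi> T \<in> multi_semigroup S T K"
    using \<phi> r(1) by (auto simp: multi_semigroup_def)
  ultimately show ?thesis
    using that r(2) by blast
qed

theorem theorem15:
  fixes G :: "real \<Rightarrow> (real \<Rightarrow> 'a::complete_space) set"
    and A :: "real \<Rightarrow> 'a set"
    and S :: "(real \<Rightarrow> 'a) set"
    and Ainf :: "'a set"
  assumes "generalized_process G"
    and "global_selected_pullback_attractor G A"
    and "quasi_invariant G A"
    and "autonomous_problem S"
    and "asymptotically_autonomous G A S"
    and "global_attractor S Ainf"
    and "forward_compact A"
  shows "((\<lambda>t. semidist (A t) Ainf) \<longlongrightarrow> 0) at_top"
proof (rule semidist_tendsto_0I)
  fix \<epsilon> :: real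
  assume "\<epsilon> > 0"
  \<comment> \<open>The starting time 0 is an arbitrary choice. Being compact, \<open>K\<close> is
    bounded and so is attracted by \<open>Ainf\<close>.\<close>
  define K where "K = closure (\<Union>s\<in>{0..}. A s)"
  have "compact K"
    using \<open>forward_compact A\<close> by (simp add: K_def forward_compact_def)
  have A_sub: "A s \<subseteq> K" if "s \<ge> 0" for s
    using that closure_subset unfolding K_def by fastforce
  have "K \<noteq> {}"
    using A_sub[of 0] \<open>global_selected_pullback_attractor G A\<close>
    by (auto simp: global_selected_pullback_attractor_def)
  then have "((\<lambda>t. semidist (multi_semigroup S t K) Ainf) \<longlongrightarrow> 0) at_top"
    using \<open>global_attractor S Ainf\<close> compact_imp_bounded[OF \<open>compact K\<close>]
    by (simp add: global_attractor_def)
  then have "\<forall>\<^sub>F t in at_top. semidist (multi_semigroup S t K) Ainf < ennreal \<epsilon>"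
    using \<open>\<epsilon> > 0\<close> by (intro order_tendstoD(2)) auto
  \<comment> \<open>Taking the maximum of the threshold with 0 makes \<open>T\<close> an admissible
    time for solutions in \<open>S\<close>.\<close>
  then obtain T where T: "T \<ge> 0" "semidist (multi_semigroup S T K) Ainf < ennreal \<epsilon>"
    unfolding eventually_at_top_linorder by (metis linear max.cobounded1 max.cobounded2)
  show "\<forall>\<^sub>F t in at_top. \<forall>x\<in>A t. infdist x Ainf \<le> \<epsilon>"
  proof (rule ccontr)
    assume *: "\<not> ?thesis"
    \<comment> \<open>The summand \<open>real n\<close> drives the times to infinity;
      \<open>T\<close> leaves room to step back by \<open>T\<close> without passing below 0.\<close>
    have "\<exists>t x. t \<ge> real n + T \<and> x \<in> A t \<and> infdist x Ainf > \<epsilon>" for n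
      using * unfolding eventually_at_top_linorder by (meson not_le)
    then obtain t x where tx: "\<And>n. t n \<ge> real n + T" "\<And>n. x n \<in> A (t n)"
        "\<And>n. infdist (x n) Ainf > \<epsilon>"
      by metis
    have "real n \<le> t n" for n
      using tx(1)[of n] \<open>T \<ge> 0\<close> by linarith
    then have "filterlim t at_top sequentially"
      by (intro filterlim_at_top_mono[OF filterlim_real_sequentially]) auto
    moreover have "t n \<ge> 0 + T" for n
      using tx(1)[of n] by linarith
    ultimately obtain r y where ry: "y \<in> multi_semigroup S T K" "(x \<circ> r) \<longlonglongrightarrow> y"
      using asymptotically_autonomous_limit[OF \<open>quasi_invariant G A\<close>
          \<open>asymptotically_autonomous G A S\<close> \<open>compact K\<close> A_sub \<open>T \<ge> 0\<close>, where t = t and x = x] tx(2) by blast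
    have "(\<lambda>n. infdist ((x \<circ> r) n) Ainf) \<longlonglongrightarrow> infdist y Ainf"
      by (intro tendsto_infdist ry)
    \<comment> \<open>The strict inequality weakens to \<le> in the limit, which still contradicts
      the strict bound at \<open>T\<close>.\<close>
    then have "\<epsilon> \<le> infdist y Ainf"
      by (rule LIMSEQ_le_const) (use tx(3) in \<open>auto intro: less_imp_le\<close>)
    then have "ennreal \<epsilon> \<le> semidist (multi_semigroup S T K) Ainf"
      using infdist_le_semidist[OF ry(1), of Ainf] ennreal_leI order_trans by blast
    with T(2) show False
      by simp
  qed
qed

end
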